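(* Let $n\ge2$, let $F^\alpha,F^\beta$ be two Minkowski norms on $\mathbb{R}^n$ with indicatrices $\Sigma^\alpha,\Sigma^\beta$, let $A\neq B$ be points of $\mathbb{R}^n$, and let $\Sigma$ be the multi-convex indicatrix formed by (the outermost parts of) $\Sigma^\alpha$ and $\Sigma^\beta$. An optimal tack point for the travel from $A$ to $B$ (first with $F^\alpha$, then with $F^\beta$) is either unique or else the set of optimal tack points is the whole straight segment from $A$ to $B$. The latter case occurs if and only if the straight segment from $A$ to $B$ is strictly time-minimizing (for the travel with velocity $\Sigma$) and $F^\alpha(B-A)=F^\beta(B-A)$.
   Context: A Minkowski norm (constant Finsler metric) on $\mathbb{R}^n$ is a continuous function $F:\mathbb{R}^n\to[0,\infty)$, positive and smooth away from $0$, positively homogeneous of degree 1 (not necessarily symmetric), whose indicatrix $\{v:F(v)=1\}$ is strongly convex (the Hessian of $\frac12F^2$ is positive definite at every $v\ne0$). An optimal tack point is a point $p\in\mathbb{R}^n$ where $\mathcal{T}(p)=F^\alpha(p-A)+F^\beta(B-p)$ attains its global minimum over $\mathbb{R}^n$. $\Sigma$ is the topological sphere which in each direction from the origin consists of the outermost of the two points of $\Sigma^\alpha$ and $\Sigma^\beta$, assumed to be multi-convex, that is, a finite union of compact $C^1$ patches of indicatrices of strictly convex norms (here $\Sigma^\alpha$ and $\Sigma^\beta$). The associated norm is $\|v\|_\Sigma=\min\{F^\alpha(v),F^\beta(v)\}$. The travel time with velocity $\Sigma$ of a (regular, piecewise smooth) curve $\gamma:[a,b]\to\mathbb{R}^n$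 is $\int_a^b\|\gamma'(s)\|_\Sigma\,ds$; a curve from $A$ to $B$ is strictly time-minimizing if its travel time is strictly smaller than that of any other (i.e. not a reparametrization of it) piecewise smooth curve from $A$ to $B$. *)

theory Defs
  imports "HOL-Analysis.Analysis"
begin

section \<open>Differentiability of higher order\<close>

text \<open>
  Meant for sets \<open>S\<close> at whose points the derivative within \<open>S\<close> is unique, namely
  open sets and nondegenerate compact intervals of the real line (where it is one-sided at the
  endpoints).
\<close>

primrec Ck_on :: "nat \<Rightarrow> 'a::euclidean_space set \<Rightarrow> ('a \<Rightarrow> 'b::real_normed_vector) \<Rightarrow> bool" where
  "Ck_on 0 S f \<longleftrightarrow> continuous_on S f"
| "Ck_on (Suc k) S f \<longleftrightarrow>
     f differentiable_on S \<and> (\<forall>v. Ck_on k S (\<lambda>x. frechet_derivative f (at x within S) v))"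

definition smooth_on :: "'a::euclidean_space set \<Rightarrow> ('a \<Rightarrow> 'b::real_normed_vector) \<Rightarrow> bool" where
  "smooth_on S f \<longleftrightarrow> (\<forall>k. Ck_on k S f)"

definition hessian :: "('a::euclidean_space \<Rightarrow> real) \<Rightarrow> 'a \<Rightarrow> 'a \<Rightarrow> 'a \<Rightarrow> real" where
  "hessian f v u w = frechet_derivative (\<lambda>x. frechet_derivative f (at x) u) (at v) w"


section \<open>Minkowski norms and indicatrices\<close>

definition minkowski_norm :: "(real ^ 'n \<Rightarrow> real) \<Rightarrow> bool" where
  "minkowski_norm F \<longleftrightarrow>
     continuous_on UNIV F \<and>
     (\<forall>v. 0 \<le> F v) \<and>
     (\<forall>v. v \<noteq> 0 \<longrightarrow> 0 < F v) \<and>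
     smooth_on (- {0}) F \<and>
     (\<forall>t v. 0 < t \<longrightarrow> F (t *\<^sub>R v) = t * F v) \<and>
     (\<forall>v u. v \<noteq> 0 \<longrightarrow> u \<noteq> 0 \<longrightarrow> 0 < hessian (\<lambda>x. (F x)\<^sup>2 / 2) v u u)"

definition indicatrix :: "(real ^ 'n \<Rightarrow> real) \<Rightarrow> (real ^ 'n) set" where
  "indicatrix F = {v. F v = 1}"

definition outer_indicatrix ::
    "(real ^ 'n \<Rightarrow> real) \<Rightarrow> (real ^ 'n \<Rightarrow> real) \<Rightarrow> (real ^ 'n) set" where
  "outer_indicatrix F G =
     {v \<in> indicatrix F \<union> indicatrix G.
        \<forall>t>0. t *\<^sub>R v \<in> indicatrix F \<union> indicatrix G \<longrightarrow> norm (t *\<^sub>R v) \<le> norm v}"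

definition outer_norm ::
    "(real ^ 'n \<Rightarrow> real) \<Rightarrow> (real ^ 'n \<Rightarrow> real) \<Rightarrow> real ^ 'n \<Rightarrow> real" where
  "outer_norm F G v = min (F v) (G v)"

lemma outer_indicatrix_eq:
  assumes "minkowski_norm F" and "minkowski_norm G"
  shows "outer_indicatrix F G = indicatrix (outer_norm F G)"
proof -
  have hom: "F (t *\<^sub>R v) = t * F v" "G (t *\<^sub>R v) = t * G v" if "t > 0" for t v
    using assms that by (simp_all add: minkowski_norm_def)
  have pos: "0 < F v" "0 < G v" if "v \<noteq> 0" for v
    using assms that by (simp_all add: minkowski_norm_def)
  have zero: "F 0 = 0" "G 0 = 0"
    using hom(1)[OF zero_less_numeral, of _ 0] hom(2)[OF zero_less_numeral, of _ 0]
    unfolding scaleR_zero_right by (metis mult_cancel_right2 num.distinct(1) numeral_eq_one_iff)+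
  have "v \<in> outer_indicatrix F G \<longleftrightarrow> min (F v) (G v) = 1" for v
  proof (cases "v = 0")
    case True
    then show ?thesis by (simp add: outer_indicatrix_def indicatrix_def zero)
  next
    case False
    note p = pos[OF False]
    have "v \<in> outer_indicatrix F G \<longleftrightarrow>
        (F v = 1 \<or> G v = 1) \<and> (\<forall>t>0. t * F v = 1 \<or> t * G v = 1 \<longrightarrow> t \<le> 1)"
      using False by (auto simp: outer_indicatrix_def indicatrix_def hom)
    also have "\<dots> \<longleftrightarrow> (F v = 1 \<or> G v = 1) \<and> 1 \<le> F v \<and> 1 \<le> G v"
    proof -
      have "(\<forall>t>0. t * c = 1 \<longrightarrow> t \<le> 1) \<longleftrightarrow> 1 \<le> c" if "0 < c" for c :: real
      proof
        assume "\<forall>t>0. t * c = 1 \<longrightarrow> t \<le> 1"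
        then have "1 / c \<le> 1" using that by auto
        then show "1 \<le> c" using that by (simp add: divide_le_eq)
      next
        assume "1 \<le> c"
        show "\<forall>t>0. t * c = 1 \<longrightarrow> t \<le> 1"
        proof (intro allI impI)
          fix t :: real
          assume "0 < t" "t * c = 1"
          then show "t \<le> 1" using mult_left_mono[OF \<open>1 \<le> c\<close>, of t] by simp
        qed
      qed
      from this[OF p(1)] this[OF p(2)] show ?thesis by metis
    qed
    also have "\<dots> \<longleftrightarrow> min (F v) (G v) = 1"
      by linarith
    finally show ?thesis .
  qed
  then show ?thesis by (auto simp: indicatrix_def outer_norm_def)
qed

text \<open>
  A compact \<open>C\<^sup>1\<close> patch of a hypersurface is the image, under a \<open>C\<^sup>1\<close> embedding,
  of a compact connected domain \<open>K\<close> of an \<open>n - 1\<close>-dimensional linear space \<open>H\<close>.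
  The embedding is defined near \<open>K\<close> in \<open>H\<close>; as a map on an open set of the ambient space it
  may be taken constant transversally to \<open>H\<close>, so that only its restriction to \<open>H\<close> matters.
  No regularity is imposed on the boundary of \<open>K\<close>.
\<close>

definition compact_C1_patch :: "(real ^ 'n) set \<Rightarrow> bool" where
  "compact_C1_patch P \<longleftrightarrow>
     (\<exists>H U K (f :: real ^ 'n \<Rightarrow> real ^ 'n).
        subspace H \<and> dim H = CARD('n) - 1 \<and>
        compact K \<and> connected K \<and> K \<subseteq> closure ((top_of_set H) interior_of K) \<and>
        open U \<and> K \<subseteq> H \<inter> U \<and>
        Ck_on 1 U f \<and> inj_on f (H \<inter> U) \<and>
        (\<forall>x\<in>H \<inter> U. inj_on (frechet_derivative f (at x)) H) \<and>
        P = f ` K)"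

text \<open>
  Indicatrices of Minkowski norms are strongly, hence strictly, convex; so no convexity
  condition on the members of \<open>\<F>\<close> is needed when they are Minkowski norms.
\<close>

definition multi_convex :: "(real ^ 'n \<Rightarrow> real) set \<Rightarrow> (real ^ 'n) set \<Rightarrow> bool" where
  "multi_convex \<F> S \<longleftrightarrow>
     (\<exists>\<P>. finite \<P> \<and> S = \<Union>\<P> \<and>
        (\<forall>P\<in>\<P>. compact_C1_patch P \<and> (\<exists>F\<in>\<F>. P \<subseteq> indicatrix F)))"


section \<open>Curves and travel times\<close>

text \<open>
  The smooth pieces are the intervals between consecutive points of \<open>T\<close>. Derivatives at the
  ends of each piece are one-sided, so corners are allowed at the points of \<open>T\<close>.
\<close>

definition regular_curve :: "real \<Rightarrow> real \<Rightarrow> (real \<Rightarrow> 'a::euclidean_space) \<Rightarrow> bool" where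
  "regular_curve a b \<gamma> \<longleftrightarrow>
     a < b \<and> continuous_on {a..b} \<gamma> \<and>
     (\<exists>T. finite T \<and> a \<in> T \<and> b \<in> T \<and> T \<subseteq> {a..b} \<and>
        (\<forall>s\<in>T. \<forall>t\<in>T. s < t \<and> {s<..<t} \<inter> T = {} \<longrightarrow>
           smooth_on {s..t} \<gamma> \<and>
           (\<forall>x\<in>{s..t}. vector_derivative \<gamma> (at x within {s..t}) \<noteq> 0)))"

definition regular_curve_from_to ::
    "'a::euclidean_space \<Rightarrow> 'a \<Rightarrow> real \<Rightarrow> real \<Rightarrow> (real \<Rightarrow> 'a) \<Rightarrow> bool" where
  "regular_curve_from_to A B a b \<gamma> \<longleftrightarrow> regular_curve a b \<gamma> \<and> \<gamma> a = A \<and> \<gamma> b = B"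

text \<open>
  Changes of parameter preserve the orientation. Being regular, \<open>\<phi>\<close> has positive one-sided
  derivatives everywhere.
\<close>

definition reparametrization_of ::
    "real \<Rightarrow> real \<Rightarrow> (real \<Rightarrow> 'a::euclidean_space) \<Rightarrow> real \<Rightarrow> real \<Rightarrow> (real \<Rightarrow> 'a) \<Rightarrow> bool" where
  "reparametrization_of c d \<eta> a b \<gamma> \<longleftrightarrow>
     (\<exists>\<phi>. regular_curve_from_to a b c d \<phi> \<and> strict_mono_on {c..d} \<phi> \<and>
        (\<forall>t\<in>{c..d}. \<eta> t = \<gamma> (\<phi> t)))"

text \<open>The two-sided derivative may fail to exist, but only at finitely many parameters.\<close>

definition travel_time ::
    "('a::euclidean_space \<Rightarrow> real) \<Rightarrow> real \<Rightarrow> real \<Rightarrow> (real \<Rightarrow> 'a) \<Rightarrow> real" where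
  "travel_time N a b \<gamma> = integral {a..b} (\<lambda>s. N (vector_derivative \<gamma> (at s)))"

definition strictly_time_minimizing ::
    "('a::euclidean_space \<Rightarrow> real) \<Rightarrow> 'a \<Rightarrow> 'a \<Rightarrow> real \<Rightarrow> real \<Rightarrow> (real \<Rightarrow> 'a) \<Rightarrow> bool" where
  "strictly_time_minimizing N A B a b \<gamma> \<longleftrightarrow>
     regular_curve_from_to A B a b \<gamma> \<and>
     (\<forall>c d \<eta>. regular_curve_from_to A B c d \<eta> \<longrightarrow> \<not> reparametrization_of c d \<eta> a b \<gamma> \<longrightarrow>
        travel_time N a b \<gamma> < travel_time N c d \<eta>)"


section \<open>Tacking\<close>

definition tack_time ::
    "(real ^ 'n \<Rightarrow> real) \<Rightarrow> (real ^ 'n \<Rightarrow> real) \<Rightarrow> real ^ 'n \<Rightarrow> real ^ 'n \<Rightarrow> real ^ 'n \<Rightarrow> real" where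
  "tack_time F G A B p = F (p - A) + G (B - p)"

definition optimal_tack_point ::
    "(real ^ 'n \<Rightarrow> real) \<Rightarrow> (real ^ 'n \<Rightarrow> real) \<Rightarrow> real ^ 'n \<Rightarrow> real ^ 'n \<Rightarrow> real ^ 'n \<Rightarrow> bool" where
  "optimal_tack_point F G A B p \<longleftrightarrow> (\<forall>q. tack_time F G A B p \<le> tack_time F G A B q)"

end

theory Submission
  imports Defs
begin

text \<open>
  The Hessian condition gives the strict inequality \<open>dF\<^sub>x v < F v\<close> unless \<open>v\<close> is a nonnegative
  multiple of \<open>x\<close>, hence the strict triangle inequality. If two tack points are optimal, equality
  holds in the triangle inequalities through their midpoint, for both norms, which puts them on the
  line through \<open>A\<close> and \<open>B\<close>; there the tack time is affine on the segment and larger outside, so the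
  whole segment is optimal.

  If the segment is optimal, the common differential \<open>l\<close> of both norms in the direction \<open>B - A\<close>
  calibrates it: \<open>l \<le> min F G\<close> with equality only on the ray of \<open>B - A\<close>, and integrating along a
  competing curve yields strict minimality. Conversely, a point \<open>p\<close> off the segment is compared
  with the segment through the broken line from \<open>A\<close> over \<open>p\<close> to \<open>B\<close>.
\<close>

section \<open>Minkowski norms\<close>

lemma minkowski_norm_pos: "minkowski_norm F \<Longrightarrow> v \<noteq> 0 \<Longrightarrow> 0 < F v"
  by (simp add: minkowski_norm_def)

lemma minkowski_norm_nonneg: "minkowski_norm F \<Longrightarrow> 0 \<le> F v"
  by (simp add: minkowski_norm_def)

lemma minkowski_norm_continuous: "minkowski_norm F \<Longrightarrow> continuous_on S F"
  unfolding minkowski_norm_def using continuous_on_subset by blast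

lemma minkowski_norm_zero:
  assumes "minkowski_norm F"
  shows "F 0 = 0"
proof -
  \<comment> \<open>Homogeneity is given for positive factors only; the factor 2 fixes the value at
    the origin.\<close>
  have "F (2 *\<^sub>R 0) = 2 * F 0"
    using assms unfolding minkowski_norm_def by (metis zero_less_numeral)
  then show ?thesis by simp
qed

lemma minkowski_norm_scaleR:
  assumes "minkowski_norm F" "0 \<le> t"
  shows "F (t *\<^sub>R v) = t * F v"
proof (cases "t = 0")
  case False
  then show ?thesis using assms by (simp add: minkowski_norm_def)
qed (simp add: minkowski_norm_zero[OF assms(1)])

lemma minkowski_norm_has_derivative:
  assumes "minkowski_norm F" "x \<noteq> 0"
  shows "(F has_derivative frechet_derivative F (at x)) (at x)"
proof -
  have "Ck_on 1 (- {0}) F"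
    using assms unfolding minkowski_norm_def smooth_on_def by blast
  then have "F differentiable_on (- {0})" by simp
  then have "F differentiable (at x)"
    using assms(2) by (simp add: differentiable_on_eq_differentiable_at open_Compl)
  then show ?thesis by (simp add: frechet_derivative_works)
qed

text \<open>\<open>Ck_on\<close> differentiates within the set; as \<open>- {0}\<close> is open,
  this agrees with the ordinary derivative at each of its points.\<close>

lemma minkowski_norm_derivative_differentiable:
  assumes "minkowski_norm F" "x \<noteq> 0"
  shows "(\<lambda>y. frechet_derivative F (at y) u) differentiable (at x)"
proof -
  have "Ck_on (Suc (Suc 0)) (- {0}) F"
    using assms unfolding minkowski_norm_def smooth_on_def by blast
  then have "(\<lambda>y. frechet_derivative F (at y within - {0}) u) differentiable_on (- {0})"
    by simp
  then have "(\<lambda>y. frechet_derivative F (at y within - {0}) u) differentiable (at x within - {0})"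
    using assms(2) by (simp add: differentiable_on_def)
  then have "(\<lambda>y. frechet_derivative F (at y) u) differentiable (at x within - {0})"
    by (rule differentiable_transform_within[OF _ zero_less_one])
      (use assms(2) in \<open>auto simp: at_within_open[of _ "- {0}"] open_Compl\<close>)
  then show ?thesis
    using assms(2) by (simp add: at_within_open[of _ "- {0}"] open_Compl)
qed

text \<open>The curve \<open>t *\<^sub>R x\<close> is differentiated under \<open>F\<close> at
  \<open>t = 1\<close> twice: by the chain rule and by homogeneity.\<close>

lemma minkowski_norm_euler:
  assumes "minkowski_norm F" "x \<noteq> 0"
  shows "frechet_derivative F (at x) x = F x"
proof -
  have "((\<lambda>t::real. t *\<^sub>R x) has_derivative (\<lambda>t. t *\<^sub>R x)) (at 1)"
    by (auto intro!: derivative_eq_intros)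
  from has_derivative_compose[OF this, of F "frechet_derivative F (at x)"]
  have "((\<lambda>t::real. F (t *\<^sub>R x)) has_derivative (\<lambda>t. frechet_derivative F (at x) (t *\<^sub>R x))) (at 1)"
    using minkowski_norm_has_derivative[OF assms] by simp
  then have "((\<lambda>t::real. t * F x) has_derivative (\<lambda>t. frechet_derivative F (at x) (t *\<^sub>R x))) (at 1)"
    by (rule has_derivative_transform_within_open[of _ _ _ _ "{0<..}"])
      (use minkowski_norm_scaleR[OF assms(1)] in auto)
  moreover have "((\<lambda>t::real. t * F x) has_derivative (\<lambda>t. t * F x)) (at 1)"
    by (auto intro!: derivative_eq_intros)
  ultimately have "(\<lambda>t. frechet_derivative F (at x) (t *\<^sub>R x)) = (\<lambda>t. t * F x)"
    by (rule has_derivative_unique)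
  from fun_cong[OF this, of 1] show ?thesis by simp
qed

section \<open>Strict convexity of the energy \<open>(F x)\<^sup>2 / 2\<close> and the triangle
  inequality\<close>

lemma energy_has_derivative:
  assumes "minkowski_norm F" "x \<noteq> 0"
  shows "((\<lambda>y. (F y)\<^sup>2 / 2) has_derivative (\<lambda>u. F x * frechet_derivative F (at x) u)) (at x)"
  using minkowski_norm_has_derivative[OF assms]
  by (auto intro!: derivative_eq_intros simp: field_simps)

lemma energy_frechet_derivative:
  assumes "minkowski_norm F" "x \<noteq> 0"
  shows "frechet_derivative (\<lambda>y. (F y)\<^sup>2 / 2) (at x) u = F x * frechet_derivative F (at x) u"
  using frechet_derivative_at[OF energy_has_derivative[OF assms]] by metis

text \<open>\<open>hessian\<close> is built from \<open>frechet_derivative\<close>, which is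
  meaningful only where a derivative exists. The product formula for the gradient and the second
  order smoothness of \<open>F\<close> provide it.\<close>

lemma energy_gradient_has_derivative:
  assumes "minkowski_norm F" "x \<noteq> 0"
  shows "((\<lambda>y. F y * frechet_derivative F (at y) u) has_derivative
    hessian (\<lambda>y. (F y)\<^sup>2 / 2) x u) (at x)"
proof -
  have "F differentiable (at x)"
    using minkowski_norm_has_derivative[OF assms] differentiableI by blast
  then have "(\<lambda>y. F y * frechet_derivative F (at y) u) differentiable (at x)"
    by (intro differentiable_mult minkowski_norm_derivative_differentiable[OF assms])
  then have d: "((\<lambda>y. F y * frechet_derivative F (at y) u) has_derivative
      frechet_derivative (\<lambda>y. F y * frechet_derivative F (at y) u) (at x)) (at x)"
    by (simp add: frechet_derivative_works)
  then have "((\<lambda>y. frechet_derivative (\<lambda>y. (F y)\<^sup>2 / 2) (at y) u) has_derivative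
      frechet_derivative (\<lambda>y. F y * frechet_derivative F (at y) u) (at x)) (at x)"
    by (rule has_derivative_transform_within_open[of _ _ _ _ "- {0}"])
      (use assms energy_frechet_derivative[OF assms(1)] in \<open>auto simp: open_Compl\<close>)
  from frechet_derivative_at[OF this] d show ?thesis
    by (simp add: hessian_def[abs_def])
qed

text \<open>Along the segment the slope of the energy has the Hessian in direction \<open>d\<close>
  as derivative, so it increases strictly; the mean value theorem then compares the increment with
  the initial slope. \<open>avoid\<close> keeps the segment where \<open>F\<close> is
  smooth.\<close>

lemma energy_above_tangent:
  assumes F: "minkowski_norm F" and "d \<noteq> 0"
    and avoid: "\<And>t. 0 \<le> t \<Longrightarrow> t \<le> 1 \<Longrightarrow> x + t *\<^sub>R d \<noteq> 0"
  shows "(F x)\<^sup>2 / 2 + F x * frechet_derivative F (at x) d < (F (x + d))\<^sup>2 / 2"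
proof -
  let ?E = "\<lambda>y. (F y)\<^sup>2 / 2" and ?p = "\<lambda>t. x + t *\<^sub>R d"
  let ?g = "\<lambda>y. F y * frechet_derivative F (at y) d"
  have p: "(?p has_derivative (\<lambda>h. h *\<^sub>R d)) (at t)" for t :: real
    by (auto intro!: derivative_eq_intros)
  have D1: "((\<lambda>t. ?E (?p t)) has_real_derivative ?g (?p t)) (at t)" if "0 \<le> t" "t \<le> 1" for t
  proof -
    note d = energy_has_derivative[OF F avoid[OF that]]
    \<comment> \<open>Linearity turns the differential from the chain rule into multiplication by a
      slope.\<close>
    have lin: "frechet_derivative F (at (?p t)) (h *\<^sub>R d) = h * frechet_derivative F (at (?p t)) d" for h
      using has_derivative_linear[OF minkowski_norm_has_derivative[OF F avoid[OF that]]]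
      by (simp add: linear_cmul)
    from has_derivative_compose[OF p d] show ?thesis
      unfolding has_field_derivative_def
      by (rule has_derivative_eq_rhs) (auto simp: lin)
  qed
  have D2: "((\<lambda>t. ?g (?p t)) has_real_derivative hessian ?E (?p t) d d) (at t)"
    if "0 \<le> t" "t \<le> 1" for t
  proof -
    note d = energy_gradient_has_derivative[OF F avoid[OF that], of d]
    have lin: "hessian ?E (?p t) d (h *\<^sub>R d) = h * hessian ?E (?p t) d d" for h
      using has_derivative_linear[OF d] by (simp add: linear_cmul)
    from has_derivative_compose[OF p d] show ?thesis
      unfolding has_field_derivative_def
      by (rule has_derivative_eq_rhs) (auto simp: lin)
  qed
  have hpos: "0 < hessian ?E (?p t) d d" if "0 \<le> t" "t \<le> 1" for t
    using F \<open>d \<noteq> 0\<close> avoid[OF that] unfolding minkowski_norm_def by blast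
  obtain z where z: "0 < z" "z < 1" "?E (?p 1) - ?E (?p 0) = (1 - 0) * ?g (?p z)"
    using MVT2[of 0 1 "\<lambda>t. ?E (?p t)" "\<lambda>t. ?g (?p t)"] D1 by auto
  have "?g (?p 0) < ?g (?p z)"
    by (rule DERIV_pos_imp_increasing[OF z(1)])
      (use D2 hpos z in \<open>meson le_less_trans less_imp_le\<close>)
  with z(3) show ?thesis by simp
qed

text \<open>Comparing \<open>x\<close> with the multiple of \<open>v\<close> on its own level set of \<open>F\<close> turns the tangent
  inequality for \<open>F\<^sup>2 / 2\<close> into one for \<open>F\<close>.\<close>

lemma minkowski_norm_fundamental_strict:
  assumes F: "minkowski_norm F" and x: "x \<noteq> 0" and v: "\<And>t. 0 \<le> t \<Longrightarrow> v \<noteq> t *\<^sub>R x"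
  shows "frechet_derivative F (at x) v < F v"
proof -
  let ?l = "frechet_derivative F (at x)"
  have lin: "linear ?l"
    using has_derivative_linear[OF minkowski_norm_has_derivative[OF F x]] .
  have euler: "?l x = F x" by (rule minkowski_norm_euler[OF F x])
  have v0: "v \<noteq> 0" using v[of 0] by simp
  note pos = minkowski_norm_pos[OF F x] minkowski_norm_pos[OF F v0]
  show ?thesis
  proof (cases "\<exists>s. v = s *\<^sub>R x")
    \<comment> \<open>A negative multiple of \<open>x\<close> is treated apart, because the segment
      from \<open>x\<close> to it meets the origin. The differential is negative there, while
      \<open>F v\<close> is positive.\<close>
    case True
    then obtain s where s: "v = s *\<^sub>R x" by blast
    then have "s < 0" using v[of s] by linarith
    then show ?thesis
      using pos euler by (simp add: s linear_cmul[OF lin]) (smt (verit) mult_neg_pos)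
  next
    case False
    define c where "c = F x / F v"
    have c: "c > 0" using pos by (simp add: c_def)
    define d where "d = c *\<^sub>R v - x"
    have no: "x + t *\<^sub>R d \<noteq> 0" for t
    proof
      assume "x + t *\<^sub>R d = 0"
      then have e: "(t * c) *\<^sub>R v = (t - 1) *\<^sub>R x" by (simp add: d_def algebra_simps)
      show False
      proof (cases "t = 0")
        case True
        then show False using e x by simp
      next
        case nz: False
        have "v = (1 / (t * c)) *\<^sub>R ((t * c) *\<^sub>R v)" using nz c by simp
        also have "\<dots> = ((t - 1) / (t * c)) *\<^sub>R x" by (simp add: e)
        finally show False using False by blast
      qed
    qed
    have "d \<noteq> 0"
    proof
      assume "d = 0"
      then have "x = c *\<^sub>R v" by (simp add: d_def)
      then have "v = (1 / c) *\<^sub>R x" using c by simp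
      then show False using False by blast
    qed
    from energy_above_tangent[OF F this no]
    have "(F x)\<^sup>2 / 2 + F x * (c * ?l v - F x) < (F (c *\<^sub>R v))\<^sup>2 / 2"
      by (simp add: d_def linear_diff[OF lin] linear_cmul[OF lin] euler)
    moreover have "F (c *\<^sub>R v) = F x"
      using minkowski_norm_scaleR[OF F, of c v] c pos by (simp add: c_def)
    ultimately have "F x * (c * ?l v) < F x * F x"
      by (simp add: power2_eq_square algebra_simps)
    then have "c * ?l v < F x" using pos by simp
    then show ?thesis using pos by (simp add: c_def field_simps)
  qed
qed

text \<open>On the ray of \<open>x\<close>, left out by the strict version, Euler's identity gives
  equality.\<close>

lemma minkowski_norm_fundamental_ineq:
  assumes "minkowski_norm F" "x \<noteq> 0"
  shows "frechet_derivative F (at x) v \<le> F v"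
proof (cases "\<exists>t\<ge>0. v = t *\<^sub>R x")
  case True
  then obtain t where "t \<ge> 0" "v = t *\<^sub>R x" by blast
  then show ?thesis
    using minkowski_norm_scaleR[OF assms(1), of t x] minkowski_norm_euler[OF assms]
      has_derivative_linear[OF minkowski_norm_has_derivative[OF assms]]
    by (simp add: linear_cmul)
next
  case False
  then show ?thesis using minkowski_norm_fundamental_strict[OF assms, of v] by fastforce
qed

text \<open>The differential at \<open>x + y\<close> is linear, lies below \<open>F\<close>, and
  equals \<open>F\<close> at \<open>x + y\<close>.\<close>

lemma minkowski_norm_triangle:
  assumes "minkowski_norm F"
  shows "F (x + y) \<le> F x + F y"
proof (cases "x + y = 0")
  case True
  then show ?thesis
    using minkowski_norm_nonneg[OF assms] by (simp add: minkowski_norm_zero[OF assms])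
next
  case False
  let ?l = "frechet_derivative F (at (x + y))"
  have "F (x + y) = ?l x + ?l y"
    using minkowski_norm_euler[OF assms False]
      has_derivative_linear[OF minkowski_norm_has_derivative[OF assms False]]
    by (simp add: linear_add)
  also have "\<dots> \<le> F x + F y"
    by (intro add_mono minkowski_norm_fundamental_ineq[OF assms False])
  finally show ?thesis .
qed

text \<open>Equality forces equality in both supporting inequalities, so \<open>x\<close> and
  \<open>y\<close> lie on the ray of \<open>x + y\<close>. If \<open>x + y\<close> vanished, both
  norms would be zero and \<open>x = y = 0\<close>.\<close>

lemma minkowski_norm_triangle_eq:
  assumes F: "minkowski_norm F" and eq: "F (x + y) = F x + F y" and ne: "x \<noteq> y"
  obtains a b where "x + y \<noteq> 0" "x = a *\<^sub>R (x + y)" "y = b *\<^sub>R (x + y)"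
proof -
  have nz: "x + y \<noteq> 0"
  proof
    assume "x + y = 0"
    then have "F x + F y = 0" using eq minkowski_norm_zero[OF F] by simp
    then have "F x = 0" "F y = 0"
      using minkowski_norm_nonneg[OF F, of x] minkowski_norm_nonneg[OF F, of y] by linarith+
    then show False
      using minkowski_norm_pos[OF F, of x] minkowski_norm_pos[OF F, of y] ne by fastforce
  qed
  let ?l = "frechet_derivative F (at (x + y))"
  have sum: "?l x + ?l y = F x + F y"
    using minkowski_norm_euler[OF F nz] eq
      has_derivative_linear[OF minkowski_norm_has_derivative[OF F nz]]
    by (simp add: linear_add)
  have le: "?l x \<le> F x" "?l y \<le> F y"
    by (intro minkowski_norm_fundamental_ineq[OF F nz])+
  have "\<exists>a. x = a *\<^sub>R (x + y)"
    using minkowski_norm_fundamental_strict[OF F nz, of x] sum le by fastforce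
  moreover have "\<exists>b. y = b *\<^sub>R (x + y)"
    using minkowski_norm_fundamental_strict[OF F nz, of y] sum le by fastforce
  ultimately show thesis using that nz by blast
qed

text \<open>The minimum on the compact unit sphere is positive, and homogeneity spreads the bound.
  It makes the tack time coercive.\<close>

lemma minkowski_norm_lower_bound:
  fixes F :: "real ^ 'n \<Rightarrow> real"
  assumes F: "minkowski_norm F"
  obtains m where "m > 0" "\<And>v. m * norm v \<le> F v"
proof -
  have "compact (sphere (0::real^'n) 1)" "sphere (0::real^'n) 1 \<noteq> {}" by auto
  from continuous_attains_inf[OF this minkowski_norm_continuous[OF F]]
  obtain u where u: "norm u = 1" "\<And>v. norm v = 1 \<Longrightarrow> F u \<le> F v" by auto
  have "F u > 0" using minkowski_norm_pos[OF F, of u] u by fastforce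
  moreover have "F u * norm v \<le> F v" for v
  proof (cases "v = 0")
    case True
    then show ?thesis using minkowski_norm_nonneg[OF F] by simp
  next
    case False
    have "F u \<le> F ((1 / norm v) *\<^sub>R v)" using u(2) False by simp
    also have "\<dots> = F v / norm v" using minkowski_norm_scaleR[OF F, of "1 / norm v" v] by simp
    finally show ?thesis using False by (simp add: field_simps)
  qed
  ultimately show thesis using that by blast
qed

section \<open>Optimal tack points\<close>

lemma ex_optimal_tack_point:
  assumes F: "minkowski_norm F" and G: "minkowski_norm G"
  shows "\<exists>p. optimal_tack_point F G A B p"
proof -
  obtain m where m: "m > 0" "\<And>v. m * norm v \<le> F v"
    using minkowski_norm_lower_bound[OF F] by blast
  \<comment> \<open>With this radius the first leg alone to a point outside the ball costs more than
    tacking at \<open>A\<close>, so a minimum over the ball is global.\<close>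
  define R where "R = tack_time F G A B A / m"
  have "R \<ge> 0"
    using m(1) minkowski_norm_nonneg[OF F] minkowski_norm_nonneg[OF G]
    by (simp add: R_def tack_time_def)
  then have "compact (cball A R)" "cball A R \<noteq> {}" by auto
  moreover have "continuous_on (cball A R) (tack_time F G A B)"
    unfolding tack_time_def[abs_def]
    by (intro continuous_intros continuous_on_compose2[OF minkowski_norm_continuous[OF F]]
        continuous_on_compose2[OF minkowski_norm_continuous[OF G]]) auto
  ultimately have "\<exists>p\<in>cball A R. \<forall>q\<in>cball A R. tack_time F G A B p \<le> tack_time F G A B q"
    by (rule continuous_attains_inf)
  then obtain p where p: "p \<in> cball A R"
      "\<And>q. q \<in> cball A R \<Longrightarrow> tack_time F G A B p \<le> tack_time F G A B q"
    by blast
  have "tack_time F G A B p \<le> tack_time F G A B q" for q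
  proof (cases "q \<in> cball A R")
    case False
    have "tack_time F G A B p \<le> tack_time F G A B A" using p(2) \<open>R \<ge> 0\<close> by simp
    also have "\<dots> \<le> m * norm (q - A)"
      using False m(1) by (simp add: R_def dist_norm norm_minus_commute field_simps)
    also have "\<dots> \<le> F (q - A)" by (rule m(2))
    also have "\<dots> \<le> tack_time F G A B q"
      using minkowski_norm_nonneg[OF G] by (simp add: tack_time_def)
    finally show ?thesis .
  qed (rule p(2))
  then show ?thesis unfolding optimal_tack_point_def by blast
qed

lemma tack_time_on_segment:
  assumes "minkowski_norm F" "minkowski_norm G" "0 \<le> s" "s \<le> 1"
  shows "tack_time F G A B (A + s *\<^sub>R (B - A)) = s * F (B - A) + (1 - s) * G (B - A)"
proof -
  have "B - (A + s *\<^sub>R (B - A)) = (1 - s) *\<^sub>R (B - A)" by (simp add: algebra_simps)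
  then show ?thesis
    using minkowski_norm_scaleR[OF assms(1), of s] minkowski_norm_scaleR[OF assms(2), of "1 - s"] assms
    by (simp add: tack_time_def)
qed

lemma in_closed_segment_iff:
  fixes A B :: "'a::real_vector"
  shows "p \<in> closed_segment A B \<longleftrightarrow> (\<exists>s. 0 \<le> s \<and> s \<le> 1 \<and> p = A + s *\<^sub>R (B - A))"
  unfolding in_segment by (simp add: algebra_simps)

text \<open>Beyond either end one leg is already too long: for \<open>s < 0\<close> the second leg
  costs more than tacking at \<open>A\<close>, for \<open>s > 1\<close> the first leg costs more
  than tacking at \<open>B\<close>.\<close>

lemma optimal_tack_point_on_line:
  assumes F: "minkowski_norm F" and G: "minkowski_norm G" and "A \<noteq> B"
    and opt: "optimal_tack_point F G A B (A + s *\<^sub>R (B - A))"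
  shows "0 \<le> s \<and> s \<le> 1"
proof -
  let ?w = "B - A"
  have w: "?w \<noteq> 0" using assms by simp
  have eq: "B - (A + s *\<^sub>R ?w) = (1 - s) *\<^sub>R ?w" by (simp add: algebra_simps)
  have T: "F (s *\<^sub>R ?w) + G ((1 - s) *\<^sub>R ?w) \<le> G ?w"
     "F (s *\<^sub>R ?w) + G ((1 - s) *\<^sub>R ?w) \<le> F ?w"
    using opt[unfolded optimal_tack_point_def, rule_format, of A]
      opt[unfolded optimal_tack_point_def, rule_format, of B]
    unfolding tack_time_def eq
    by (simp_all add: minkowski_norm_zero[OF F] minkowski_norm_zero[OF G])
  have "0 \<le> s"
  proof (rule ccontr)
    assume s: "\<not> 0 \<le> s"
    have "G ((1 - s) *\<^sub>R ?w) = (1 - s) * G ?w"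
      using minkowski_norm_scaleR[OF G] s by simp
    moreover have "(1 - s) * G ?w > G ?w"
      using s minkowski_norm_pos[OF G w] by simp
    ultimately show False
      using T minkowski_norm_nonneg[OF F, of "s *\<^sub>R ?w"] by linarith
  qed
  moreover have "s \<le> 1"
  proof (rule ccontr)
    assume s: "\<not> s \<le> 1"
    have "F (s *\<^sub>R ?w) = s * F ?w"
      using minkowski_norm_scaleR[OF F] s by simp
    moreover have "s * F ?w > F ?w"
      using s minkowski_norm_pos[OF F w] by simp
    ultimately show False
      using T minkowski_norm_nonneg[OF G, of "(1 - s) *\<^sub>R ?w"] by linarith
  qed
  ultimately show ?thesis ..
qed

text \<open>Equality in the triangle inequality for \<open>F\<close> makes the first legs multiples
  of one vector \<open>u\<close>, that for \<open>G\<close> makes the second legs multiples of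
  \<open>u'\<close>. These vectors are parallel to each other, hence to
  \<open>B - A\<close>.\<close>

lemma two_optimal_tack_points_on_line:
  assumes F: "minkowski_norm F" and G: "minkowski_norm G" and "A \<noteq> B"
    and p: "optimal_tack_point F G A B p" and q: "optimal_tack_point F G A B q" and "p \<noteq> q"
  shows "\<exists>s. p = A + s *\<^sub>R (B - A)"
proof -
  let ?m = "(1/2) *\<^sub>R (p + q)"
  define x y x' y' where "x = p - A" and "y = q - A" and "x' = B - p" and "y' = B - q"
  note defs = this
  have mA: "?m - A = (1/2) *\<^sub>R (x + y)" and mB: "B - ?m = (1/2) *\<^sub>R (x' + y')"
    by (simp_all add: defs vec_eq_iff field_simps)
  have half: "tack_time F G A B ?m = (1/2) * F (x + y) + (1/2) * G (x' + y')"
    unfolding tack_time_def mA mB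
    by (simp add: minkowski_norm_scaleR[OF F] minkowski_norm_scaleR[OF G])
  have "F x + G x' \<le> tack_time F G A B ?m" "F y + G y' \<le> tack_time F G A B ?m"
    using p q unfolding optimal_tack_point_def defs by (simp_all add: tack_time_def)
  \<comment> \<open>The two optimality inequalities are added; the factor 1/2 in the midpoint
    cancels.\<close>
  with half have "F x + F y + (G x' + G y') \<le> F (x + y) + G (x' + y')" by simp
  then have eq: "F (x + y) = F x + F y" "G (x' + y') = G x' + G y'"
    using minkowski_norm_triangle[OF F, of x y] minkowski_norm_triangle[OF G, of x' y'] by linarith+
  have ne: "x \<noteq> y" "x' \<noteq> y'" using \<open>p \<noteq> q\<close> by (simp_all add: defs)
  obtain a b where ab: "x = a *\<^sub>R (x + y)" "y = b *\<^sub>R (x + y)"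
    using minkowski_norm_triangle_eq[OF F eq(1) ne(1)] by metis
  obtain a' b' where ab': "x' = a' *\<^sub>R (x' + y')" "y' = b' *\<^sub>R (x' + y')"
    using minkowski_norm_triangle_eq[OF G eq(2) ne(2)] by metis
  define u u' where "u = x + y" and "u' = x' + y'"
  \<comment> \<open>The common endpoints \<open>A\<close> and \<open>B\<close> tie the second legs
    to the first ones; this is what relates \<open>u'\<close> to \<open>u\<close>.\<close>
  have "x' - y' = y - x" by (simp add: defs)
  then have "(a' - b') *\<^sub>R u' = (b - a) *\<^sub>R u"
    using ab ab' unfolding u_def u'_def by (metis scaleR_left_diff_distrib)
  moreover have "a' \<noteq> b'" using ab' ne by metis
  ultimately have u': "u' = ((b - a) / (a' - b')) *\<^sub>R u"
    by (simp add: eq_vector_fraction_iff)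
  \<comment> \<open>The coefficient of \<open>B - A\<close>, the sum of both legs, with respect to
    \<open>u\<close>; it is nonzero because \<open>A \<noteq> B\<close>.\<close>
  define k where "k = a + a' * ((b - a) / (a' - b'))"
  have "B - A = x + x'" by (simp add: defs)
  also have "\<dots> = a *\<^sub>R u + a' *\<^sub>R u'" using ab ab' unfolding u_def u'_def by metis
  also have "\<dots> = k *\<^sub>R u" by (simp add: u' k_def scaleR_left_distrib)
  finally have w: "B - A = k *\<^sub>R u" .
  then have "k \<noteq> 0" using \<open>A \<noteq> B\<close> by auto
  then have "x = (a / k) *\<^sub>R (B - A)" using ab by (simp add: w u_def)
  then show ?thesis unfolding x_def by (metis add.commute diff_add_cancel)
qed

lemma optimal_tack_points_dichotomy:
  assumes F: "minkowski_norm F" and G: "minkowski_norm G" and AB: "A \<noteq> B"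
  shows "(\<exists>!p. optimal_tack_point F G A B p) \<or>
    {p. optimal_tack_point F G A B p} = closed_segment A B"
proof (cases "\<exists>!p. optimal_tack_point F G A B p")
  case False
  let ?opt = "optimal_tack_point F G A B" and ?f = "F (B - A)" and ?g = "G (B - A)"
  obtain p q where pq: "?opt p" "?opt q" "p \<noteq> q"
    using False ex_optimal_tack_point[OF F G, of A B] by blast
  \<comment> \<open>Every optimal point differs from \<open>p\<close> or from \<open>q\<close>, so
    it has a partner for the two-point argument.\<close>
  have seg: "\<exists>s. 0 \<le> s \<and> s \<le> 1 \<and> z = A + s *\<^sub>R (B - A)" if z: "?opt z" for z
  proof -
    obtain z' where "?opt z'" "z \<noteq> z'" using pq by metis
    then show ?thesis
      using two_optimal_tack_points_on_line[OF F G AB z] optimal_tack_point_on_line[OF F G AB] z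
      by blast
  qed
  obtain s t where st: "0 \<le> s" "s \<le> 1" "p = A + s *\<^sub>R (B - A)"
      "0 \<le> t" "t \<le> 1" "q = A + t *\<^sub>R (B - A)"
    using seg[OF pq(1)] seg[OF pq(2)] by blast
  have "tack_time F G A B p = tack_time F G A B q"
    using pq unfolding optimal_tack_point_def by (meson order_antisym)
  then have "s * ?f + (1 - s) * ?g = t * ?f + (1 - t) * ?g"
    using st by (simp add: tack_time_on_segment[OF F G])
  \<comment> \<open>On the segment the tack time is affine with slope \<open>?f - ?g\<close>; equal
    values at two parameters make it constant.\<close>
  then have "(s - t) * (?f - ?g) = 0" by (simp add: algebra_simps)
  moreover have "s \<noteq> t" using pq(3) st by auto
  ultimately have fg: "?f = ?g" by simp
  have "?opt z" if z: "z \<in> closed_segment A B" for z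
  proof -
    obtain r where r: "0 \<le> r" "r \<le> 1" "z = A + r *\<^sub>R (B - A)"
      using z unfolding in_closed_segment_iff by blast
    have "tack_time F G A B (A + x *\<^sub>R (B - A)) = ?f" if "0 \<le> x" "x \<le> 1" for x
      unfolding tack_time_on_segment[OF F G that] fg by (simp add: algebra_simps)
    then have "tack_time F G A B z = tack_time F G A B p"
      using r st by simp
    then show ?thesis using pq(1) by (simp add: optimal_tack_point_def)
  qed
  moreover have "z \<in> closed_segment A B" if "?opt z" for z
    using seg[OF that] unfolding in_closed_segment_iff .
  ultimately show ?thesis by blast
qed simp

text \<open>The first order condition at the midpoint of the segment says that both norms have the same
  differential in the direction of the segment; this differential is the calibration.\<close>

lemma tack_segment_calibration:
  assumes F: "minkowski_norm F" and G: "minkowski_norm G" and AB: "A \<noteq> B"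
    and opt: "{p. optimal_tack_point F G A B p} = closed_segment A B"
  obtains l where "bounded_linear l" "l (B - A) = F (B - A)"
    "\<And>v. l v \<le> outer_norm F G v"
    "\<And>v. l v = outer_norm F G v \<Longrightarrow> \<exists>t\<ge>0. v = t *\<^sub>R (B - A)"
proof -
  \<comment> \<open>At the midpoint both legs equal \<open>w\<close>, so the two differentials are
    taken at the same vector.\<close>
  define w where "w = (1/2) *\<^sub>R (B - A)"
  have w: "w \<noteq> 0" using AB by (simp add: w_def)
  have half: "A + w \<in> closed_segment A B"
    unfolding in_closed_segment_iff w_def by (rule exI[of _ "1/2"]) simp
  then have min: "optimal_tack_point F G A B (A + w)" using opt by blast
  let ?l = "frechet_derivative F (at w)" and ?k = "frechet_derivative G (at w)"
  have "w + w = B - A" by (simp add: w_def flip: scaleR_left_distrib)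
  then have e: "B - (A + w) = w" by (metis add_diff_cancel_right' diff_diff_eq)
  have dF: "(F has_derivative ?l) (at (A + w - A))" and dG: "(G has_derivative ?k) (at (B - (A + w)))"
    unfolding e using minkowski_norm_has_derivative[OF F w] minkowski_norm_has_derivative[OF G w]
    by simp_all
  have "((\<lambda>p. p - A) has_derivative (\<lambda>h. h)) (at (A + w))"
       "((\<lambda>p. B - p) has_derivative (\<lambda>h. - h)) (at (A + w))"
    by (auto intro!: derivative_eq_intros)
  from has_derivative_add[OF has_derivative_compose[OF this(1) dF] has_derivative_compose[OF this(2) dG]]
  have "(tack_time F G A B has_derivative (\<lambda>h. ?l h + ?k (- h))) (at (A + w))"
    by (simp add: tack_time_def[abs_def])
  \<comment> \<open>The derivative vanishes at the minimum. The second leg enters with a minus sign,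
    so the two differentials coincide.\<close>
  then have "(\<lambda>h. ?l h + ?k (- h)) = (\<lambda>h. 0)"
    by (rule differential_zero_maxmin[of "A + w" UNIV, rotated 2])
      (use min in \<open>auto simp: optimal_tack_point_def\<close>)
  then have lk: "?l h = ?k h" for h
    using has_derivative_linear[OF minkowski_norm_has_derivative[OF G w]]
    by (auto simp: linear_neg dest: fun_cong[of _ _ h])
  have bl: "bounded_linear ?l"
    using has_derivative_bounded_linear[OF minkowski_norm_has_derivative[OF F w]] .
  have BA: "B - A = 2 *\<^sub>R w" by (simp add: w_def)
  show thesis
  proof (rule that[OF bl])
    show "?l (B - A) = F (B - A)"
      unfolding BA using minkowski_norm_euler[OF F w] minkowski_norm_scaleR[OF F, of 2 w]
        has_derivative_linear[OF minkowski_norm_has_derivative[OF F w]]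
      by (simp add: linear_cmul)
    show "?l v \<le> outer_norm F G v" for v
      using minkowski_norm_fundamental_ineq[OF F w, of v] minkowski_norm_fundamental_ineq[OF G w, of v] lk
      by (simp add: outer_norm_def)
    show "\<exists>t\<ge>0. v = t *\<^sub>R (B - A)" if v: "?l v = outer_norm F G v" for v
    proof -
      \<comment> \<open>The minimum is attained by one of the norms, and the form is the
        differential of either; strictness for that norm puts \<open>v\<close> on the ray.\<close>
      have "\<not> ?l v < F v \<or> \<not> ?k v < G v"
        using v lk unfolding outer_norm_def by (metis min_def order_less_irrefl)
      then obtain t where "t \<ge> 0" "v = t *\<^sub>R w"
        using minkowski_norm_fundamental_strict[OF F w, of v] minkowski_norm_fundamental_strict[OF G w, of v]
        by blast
      then show ?thesis by (intro exI[of _ "t/2"]) (simp add: BA)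
    qed
  qed
qed

section \<open>Curves\<close>

text \<open>\<open>frechet_derivative\<close> chooses among the derivatives; both functions have the
  same ones, so the choice agrees even where it is not unique.\<close>

lemma frechet_derivative_cong:
  assumes "\<And>x. x \<in> S \<Longrightarrow> f x = g x" "x \<in> S"
  shows "frechet_derivative f (at x within S) = frechet_derivative g (at x within S)"
proof -
  have "(f has_derivative D) (at x within S) \<longleftrightarrow> (g has_derivative D) (at x within S)" for D
    using has_derivative_transform[of x S f g D] has_derivative_transform[of x S g f D] assms by metis
  then show ?thesis unfolding frechet_derivative_def by presburger
qed

lemma Ck_on_cong:
  assumes "\<And>x. x \<in> S \<Longrightarrow> f x = g x"
  shows "Ck_on k S f \<longleftrightarrow> Ck_on k S g"
  using assms
proof (induction k arbitrary: f g)
  case 0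
  then show ?case using continuous_on_cong[of S S f g] by simp
next
  case (Suc k)
  have "f differentiable_on S \<longleftrightarrow> g differentiable_on S"
    using Suc.prems has_derivative_transform[of _ S f g] has_derivative_transform[of _ S g f]
    unfolding differentiable_on_def differentiable_def by metis
  moreover have "Ck_on k S (\<lambda>x. frechet_derivative f (at x within S) v) \<longleftrightarrow>
      Ck_on k S (\<lambda>x. frechet_derivative g (at x within S) v)" for v
    using frechet_derivative_cong[of S f g] Suc.prems by (intro Suc.IH) metis
  ultimately show ?case by simp
qed

lemma frechet_derivative_within_interval:
  fixes f :: "real \<Rightarrow> 'b::real_normed_vector"
  assumes "s < t" "x \<in> {s..t}" "(f has_derivative D) (at x within {s..t})"
  shows "frechet_derivative f (at x within {s..t}) = D"
  using frechet_derivative_within_cbox[of s t x f D] assms by simp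

text \<open>The derivative has the same shape with constant 0, hence the induction generalizes over
  \<open>c\<close> as well as \<open>f\<close>.\<close>

lemma Ck_on_bounded_linear:
  fixes f :: "real \<Rightarrow> 'a::real_normed_vector"
  assumes "s < t" and L: "bounded_linear L"
  shows "Ck_on k {s..t} f \<Longrightarrow> Ck_on k {s..t} (\<lambda>x. c + L (f x))"
proof (induction k arbitrary: f c)
  case 0
  then show ?case
    by (auto intro!: continuous_intros bounded_linear.continuous_on[OF L])
next
  case (Suc k)
  have D: "((\<lambda>x. c + L (f x)) has_derivative
      (\<lambda>v. 0 + L (frechet_derivative f (at x within {s..t}) v))) (at x within {s..t})"
    if "x \<in> {s..t}" for x
    using Suc.prems that
    by (intro derivative_intros bounded_linear.has_derivative[OF L])
      (auto simp: differentiable_on_def frechet_derivative_works)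
  have "Ck_on k {s..t} (\<lambda>x. frechet_derivative (\<lambda>x. c + L (f x)) (at x within {s..t}) v)" for v
  proof (subst Ck_on_cong)
    show "Ck_on k {s..t} (\<lambda>x. 0 + L (frechet_derivative f (at x within {s..t}) v))"
      using Suc.prems by (intro Suc.IH) simp
  qed (use frechet_derivative_within_interval[OF \<open>s < t\<close> _ D] in simp)
  moreover have "(\<lambda>x. c + L (f x)) differentiable_on {s..t}"
    using D unfolding differentiable_on_def differentiable_def by blast
  ultimately show ?case by simp
qed

lemma Ck_on_const:
  assumes "s < t"
  shows "Ck_on k {s..t} (\<lambda>x::real. c)"
proof (induction k arbitrary: c)
  case (Suc k)
  have "Ck_on k {s..t} (\<lambda>x. frechet_derivative (\<lambda>x. c) (at x within {s..t}) v)" for v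
    by (rule Ck_on_cong[THEN iffD2, OF _ Suc[of 0]])
      (simp add: frechet_derivative_within_interval[OF assms _ has_derivative_const])
  then show ?case by simp
qed simp

lemma smooth_on_line:
  assumes "s < t"
  shows "smooth_on {s..t} (\<lambda>x::real. p + x *\<^sub>R v)"
proof -
  have D: "((\<lambda>x. x) has_derivative (\<lambda>h. h)) (at x within {s..t})" for x :: real
    by (rule has_derivative_ident)
  have "Ck_on k {s..t} (\<lambda>x::real. x)" for k
  proof (cases k)
    case (Suc j)
    have "Ck_on j {s..t} (\<lambda>x. frechet_derivative (\<lambda>x. x) (at x within {s..t}) h)" for h
      by (rule Ck_on_cong[THEN iffD2, OF _ Ck_on_const[OF assms, of j h]])
        (simp add: frechet_derivative_within_interval[OF assms _ D])
    then show ?thesis by (simp add: Suc differentiable_on_def)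
  qed simp
  from Ck_on_bounded_linear[OF assms bounded_linear_scaleR_left this, where c = p]
  show ?thesis unfolding smooth_on_def by simp
qed

text \<open>Smoothness of a piece concerns one-sided derivatives at its ends, whereas
  \<open>travel_time\<close> uses two-sided ones. They agree except possibly at \<open>s\<close> and
  \<open>t\<close>, which integrals do not see.\<close>

lemma smooth_on_interval_derivative:
  fixes \<gamma> :: "real \<Rightarrow> 'a::euclidean_space"
  assumes "smooth_on {s..t} \<gamma>" "s < t"
  defines "g \<equiv> \<lambda>x. vector_derivative \<gamma> (at x within {s..t})"
  shows "continuous_on {s..t} g"
    and "\<And>x. x \<in> {s..t} \<Longrightarrow> (\<gamma> has_vector_derivative g x) (at x within {s..t})"
    and "\<And>x. x \<in> {s<..<t} \<Longrightarrow> (\<gamma> has_vector_derivative g x) (at x)"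
    and "\<And>x. x \<in> {s..t} - {s, t} \<Longrightarrow> vector_derivative \<gamma> (at x) = g x"
proof -
  have C1: "Ck_on 1 {s..t} \<gamma>" using assms(1) unfolding smooth_on_def by blast
  show D: "(\<gamma> has_vector_derivative g x) (at x within {s..t})" if "x \<in> {s..t}" for x
    using C1 that by (simp add: g_def differentiable_on_def flip: vector_derivative_works)
  have "frechet_derivative \<gamma> (at x within {s..t}) 1 = g x" if "x \<in> {s..t}" for x
    by (simp add: frechet_derivative_within_interval[OF \<open>s < t\<close> that
          D[OF that, unfolded has_vector_derivative_def]])
  moreover have "continuous_on {s..t} (\<lambda>x. frechet_derivative \<gamma> (at x within {s..t}) 1)"
    using C1 by simp
  ultimately show "continuous_on {s..t} g"
    by (rule continuous_on_eq[rotated])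
  show at: "(\<gamma> has_vector_derivative g x) (at x)" if "x \<in> {s<..<t}" for x
    using D[of x] that at_within_interior[of x "{s..t}"] by simp
  show "vector_derivative \<gamma> (at x) = g x" if "x \<in> {s..t} - {s, t}" for x
    using that by (intro vector_derivative_at[OF at]) auto
qed

section \<open>Integration along piecewise smooth curves\<close>

text \<open>Splitting at an interior partition point lowers the number of such points in both
  halves. This lifts facts from smooth pieces to whole curves.\<close>

lemma partition_induct:
  fixes a b :: "'a::linorder"
  assumes "finite T" "a \<in> T" "b \<in> T" "a < b"
    and piece: "\<And>s t. s \<in> T \<Longrightarrow> t \<in> T \<Longrightarrow> s < t \<Longrightarrow> {s<..<t} \<inter> T = {} \<Longrightarrow> P s t"
    and join: "\<And>s m t. s < m \<Longrightarrow> m < t \<Longrightarrow> P s m \<Longrightarrow> P m t \<Longrightarrow> P s t"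
  shows "P a b"
  using assms(2-4)
proof (induction "card ({a<..<b} \<inter> T)" arbitrary: a b rule: less_induct)
  case less
  show ?case
  proof (cases "{a<..<b} \<inter> T = {}")
    case True
    then show ?thesis using piece less.prems by blast
  next
    case False
    then obtain m where m: "a < m" "m < b" "m \<in> T" by auto
    have "{a<..<m} \<inter> T \<subset> {a<..<b} \<inter> T" "{m<..<b} \<inter> T \<subset> {a<..<b} \<inter> T"
      using m by auto
    then have "P a m" "P m b"
      using less m \<open>finite T\<close> by (simp_all add: psubset_card_mono)
    then show ?thesis using join m by blast
  qed
qed

lemma regular_curveE:
  assumes "regular_curve a b \<gamma>"
  obtains T where "finite T" "a \<in> T" "b \<in> T" "a < b" "T \<subseteq> {a..b}"
    "\<And>s t. s \<in> T \<Longrightarrow> t \<in> T \<Longrightarrow> s < t \<Longrightarrow> {s<..<t} \<inter> T = {} \<Longrightarrow>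
      smooth_on {s..t} \<gamma> \<and> (\<forall>x\<in>{s..t}. vector_derivative \<gamma> (at x within {s..t}) \<noteq> 0)"
proof -
  have "a < b" using assms unfolding regular_curve_def by (elim conjE)
  have "\<exists>T. finite T \<and> a \<in> T \<and> b \<in> T \<and> T \<subseteq> {a..b} \<and>
        (\<forall>s\<in>T. \<forall>t\<in>T. s < t \<and> {s<..<t} \<inter> T = {} \<longrightarrow>
           smooth_on {s..t} \<gamma> \<and>
           (\<forall>x\<in>{s..t}. vector_derivative \<gamma> (at x within {s..t}) \<noteq> 0))"
    using assms unfolding regular_curve_def by (elim conjE)
  then show thesis
    by (elim exE conjE) (rule that, assumption+, rule \<open>a < b\<close>, assumption, meson)
qed

lemma regular_curve_integrable:
  assumes "regular_curve a b \<gamma>" and N: "continuous_on UNIV (N :: _ \<Rightarrow> real)"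
  shows "(\<lambda>x. N (vector_derivative \<gamma> (at x))) integrable_on {a..b}"
proof -
  obtain T where T: "finite T" "a \<in> T" "b \<in> T" "a < b"
    and sm: "\<And>s t. s \<in> T \<Longrightarrow> t \<in> T \<Longrightarrow> s < t \<Longrightarrow> {s<..<t} \<inter> T = {} \<Longrightarrow> smooth_on {s..t} \<gamma>"
    using regular_curveE[OF assms(1)] by metis
  show ?thesis using T
  proof (rule partition_induct)
    fix s t assume st: "s \<in> T" "t \<in> T" "s < t" "{s<..<t} \<inter> T = {}"
    note D = smooth_on_interval_derivative[OF sm[OF st] \<open>s < t\<close>]
    have "(\<lambda>x. N (vector_derivative \<gamma> (at x within {s..t}))) integrable_on {s..t}"
      by (intro integrable_continuous_real continuous_on_compose2[OF N D(1)]) auto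
    then show "(\<lambda>x. N (vector_derivative \<gamma> (at x))) integrable_on {s..t}"
      by (rule integrable_spike_finite[of "{s, t}", rotated 2]) (simp, simp only: D(4))
  next
    fix s m t :: real assume "s < m" "m < t"
      "(\<lambda>x. N (vector_derivative \<gamma> (at x))) integrable_on {s..m}"
      "(\<lambda>x. N (vector_derivative \<gamma> (at x))) integrable_on {m..t}"
    then show "(\<lambda>x. N (vector_derivative \<gamma> (at x))) integrable_on {s..t}"
      by (intro Henstock_Kurzweil_Integration.integrable_combine[of s m t]) auto
  qed
qed

text \<open>The fundamental theorem of calculus holds on each piece, and the increments telescope
  over the corners.\<close>

lemma regular_curve_linear_integral:
  assumes "regular_curve a b \<gamma>" and l: "bounded_linear (l :: _ \<Rightarrow> real)"
  shows "((\<lambda>x. l (vector_derivative \<gamma> (at x))) has_integral (l (\<gamma> b) - l (\<gamma> a))) {a..b}"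
proof -
  obtain T where T: "finite T" "a \<in> T" "b \<in> T" "a < b"
    and sm: "\<And>s t. s \<in> T \<Longrightarrow> t \<in> T \<Longrightarrow> s < t \<Longrightarrow> {s<..<t} \<inter> T = {} \<Longrightarrow> smooth_on {s..t} \<gamma>"
    using regular_curveE[OF assms(1)] by metis
  show ?thesis using T
  proof (rule partition_induct)
    fix s t assume st: "s \<in> T" "t \<in> T" "s < t" "{s<..<t} \<inter> T = {}"
    note D = smooth_on_interval_derivative[OF sm[OF st] \<open>s < t\<close>]
    have "((\<lambda>x. l (vector_derivative \<gamma> (at x within {s..t}))) has_integral (l (\<gamma> t) - l (\<gamma> s))) {s..t}"
      using \<open>s < t\<close>
      by (intro fundamental_theorem_of_calculus bounded_linear.has_vector_derivative[OF l] D(2)) auto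
    then show "((\<lambda>x. l (vector_derivative \<gamma> (at x))) has_integral (l (\<gamma> t) - l (\<gamma> s))) {s..t}"
      by (rule has_integral_spike_finite[of "{s, t}", rotated 2]) (simp, simp only: D(4))
  next
    fix s m t :: real assume "s < m" "m < t"
      "((\<lambda>x. l (vector_derivative \<gamma> (at x))) has_integral (l (\<gamma> m) - l (\<gamma> s))) {s..m}"
      "((\<lambda>x. l (vector_derivative \<gamma> (at x))) has_integral (l (\<gamma> t) - l (\<gamma> m))) {m..t}"
    then show "((\<lambda>x. l (vector_derivative \<gamma> (at x))) has_integral (l (\<gamma> t) - l (\<gamma> s))) {s..t}"
      using has_integral_combine[of s m t] by fastforce
  qed
qed

section \<open>Calibration by a linear form\<close>

text \<open>The integral of \<open>l\<close> depends only on the endpoints, and \<open>N\<close>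
  dominates its integrand.\<close>

lemma calibration_bound:
  assumes \<eta>: "regular_curve_from_to A B c d \<eta>" and N: "continuous_on UNIV N"
    and l: "bounded_linear l" and le: "\<And>v. l v \<le> N v"
  shows "l (B - A) \<le> travel_time N c d \<eta>"
proof -
  have reg: "regular_curve c d \<eta>" and ends: "\<eta> c = A" "\<eta> d = B"
    using \<eta> by (auto simp: regular_curve_from_to_def)
  note hl = regular_curve_linear_integral[OF reg l, unfolded ends]
  have "l B - l A = integral {c..d} (\<lambda>x. l (vector_derivative \<eta> (at x)))"
    using hl by (simp add: integral_unique)
  also have "\<dots> \<le> integral {c..d} (\<lambda>x. N (vector_derivative \<eta> (at x)))"
    using hl le regular_curve_integrable[OF reg N]
    by (intro integral_le) (auto intro: has_integral_integrable)
  finally show ?thesis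
    using bounded_linear.linear[OF l] by (simp add: travel_time_def linear_diff)
qed

text \<open>The excess of \<open>N\<close> over \<open>l\<close> is nonnegative with total integral
  0, so its integral over every piece is 0 too.\<close>

lemma calibration_eq_derivative:
  assumes reg: "regular_curve c d \<eta>" and N: "continuous_on UNIV N"
    and l: "bounded_linear l" and le: "\<And>v. l v \<le> N v"
    and eq: "travel_time N c d \<eta> = l (\<eta> d) - l (\<eta> c)"
    and st: "c \<le> s" "s < t" "t \<le> d" "smooth_on {s..t} \<eta>" and x: "x \<in> {s..t}"
  shows "l (vector_derivative \<eta> (at x within {s..t})) = N (vector_derivative \<eta> (at x within {s..t}))"
proof -
  let ?h = "\<lambda>x. N (vector_derivative \<eta> (at x)) - l (vector_derivative \<eta> (at x))"
  let ?k = "\<lambda>x. N (vector_derivative \<eta> (at x within {s..t})) - l (vector_derivative \<eta> (at x within {s..t}))"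
  note D = smooth_on_interval_derivative[OF st(4,2)]
  have h0: "(?h has_integral 0) {c..d}"
    using has_integral_diff[OF integrable_integral[OF regular_curve_integrable[OF reg N]]
        regular_curve_linear_integral[OF reg l]] eq
    by (simp add: travel_time_def)
  have sub: "{s..t} \<subseteq> {c..d}" using st by auto
  have int: "?h integrable_on {s..t}"
    using h0 sub integrable_on_subinterval has_integral_integrable by blast
  have "integral {s..t} ?h \<le> integral {c..d} ?h"
    using sub int h0 le by (intro integral_subset_le) (auto intro: has_integral_integrable)
  moreover have "0 \<le> integral {s..t} ?h"
    using int le by (intro integral_nonneg) auto
  ultimately have "integral {s..t} ?h = 0" using integral_unique[OF h0] by simp
  then have "(?h has_integral 0) {s..t}" using integrable_integral[OF int] by simp
  \<comment> \<open>With one-sided derivatives the integrand is continuous, so it vanishes at every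
    point, ends included.\<close>
  then have "(?k has_integral 0) {s..t}"
    by (rule has_integral_spike_finite[of "{s, t}", rotated 2]) (simp, simp only: D(4))
  moreover have "continuous_on {s..t} ?k"
    by (intro continuous_intros continuous_on_compose2[OF N D(1)]
        bounded_linear.continuous_on[OF l D(1)]) auto
  ultimately have "?k x = 0"
    using has_integral_0_cbox_imp_0[of s t ?k x] le st x by simp
  then show ?thesis by simp
qed

text \<open>Equality puts all velocities on the ray of \<open>B - A\<close>, so the curve moves
  forward along the line; its coordinate there is the change of parameter.\<close>

lemma calibration_eq_reparametrization:
  fixes A B :: "'a::euclidean_space"
  assumes \<eta>: "regular_curve_from_to A B c d \<eta>" and N: "continuous_on UNIV N" and "A \<noteq> B"
    and l: "bounded_linear l" and le: "\<And>v. l v \<le> N v"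
    and tight: "\<And>v. l v = N v \<Longrightarrow> \<exists>t\<ge>0. v = t *\<^sub>R (B - A)"
    and eq: "travel_time N c d \<eta> = l (B - A)"
  shows "reparametrization_of c d \<eta> 0 1 (linepath A B)"
proof -
  define w where "w = B - A"
  \<comment> \<open>\<open>L\<close> is the coordinate along \<open>w\<close> by orthogonal
    projection, \<open>\<phi>\<close> that of the curve relative to \<open>A\<close>, and
    \<open>\<psi>\<close> the remainder, to be shown constant.\<close>
  define L where "L = (\<lambda>v. (v \<bullet> w) / (w \<bullet> w))"
  define \<phi> where "\<phi> = (\<lambda>x. - L A + L (\<eta> x))"
  define \<psi> where "\<psi> = (\<lambda>x. \<eta> x - \<phi> x *\<^sub>R w)"
  have w: "w \<noteq> 0" using \<open>A \<noteq> B\<close> by (simp add: w_def)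
  have L: "bounded_linear L"
    unfolding L_def by (rule bounded_linear_compose[OF bounded_linear_divide bounded_linear_inner_left])
  have Lw: "L (r *\<^sub>R w) = r" for r using w by (simp add: L_def)
  have reg: "regular_curve c d \<eta>" and ends: "\<eta> c = A" "\<eta> d = B"
    using \<eta> by (auto simp: regular_curve_from_to_def)
  then have cont: "continuous_on {c..d} \<eta>" unfolding regular_curve_def by (elim conjE)
  obtain T where T: "finite T" "c \<in> T" "d \<in> T" "c < d" "T \<subseteq> {c..d}"
    and pieces: "\<And>s t. s \<in> T \<Longrightarrow> t \<in> T \<Longrightarrow> s < t \<Longrightarrow> {s<..<t} \<inter> T = {} \<Longrightarrow>
        smooth_on {s..t} \<eta> \<and> (\<forall>x\<in>{s..t}. vector_derivative \<eta> (at x within {s..t}) \<noteq> 0)"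
    using regular_curveE[OF reg] by metis
  have eq': "travel_time N c d \<eta> = l (\<eta> d) - l (\<eta> c)"
    using eq bounded_linear.linear[OF l] by (simp add: ends linear_diff)
  let ?D = "\<lambda>s t x. vector_derivative \<eta> (at x within {s..t})"
  have dir: "0 < L (?D s t x) \<and> ?D s t x = L (?D s t x) *\<^sub>R w"
    if st: "s \<in> T" "t \<in> T" "s < t" "{s<..<t} \<inter> T = {}" and x: "x \<in> {s..t}" for s t x
  proof -
    have "c \<le> s" "t \<le> d" using st T(5) by auto
    then have "l (?D s t x) = N (?D s t x)"
      using pieces[OF st] st x by (intro calibration_eq_derivative[OF reg N l le eq']) auto
    from tight[OF this] obtain r where r: "r \<ge> 0" "?D s t x = r *\<^sub>R w"
      unfolding w_def by blast
    \<comment> \<open>Regularity of the curve excludes a zero velocity.\<close>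
    moreover have "r \<noteq> 0" using r pieces[OF st] x by auto
    ultimately show ?thesis using Lw[of r] by simp
  qed
  have \<phi>D: "(\<phi> has_vector_derivative L (?D s t x)) (at x within {s..t})"
    if st: "s \<in> T" "t \<in> T" "s < t" "{s<..<t} \<inter> T = {}" and x: "x \<in> {s..t}" for s t x
    using has_vector_derivative_add[OF has_vector_derivative_const bounded_linear.has_vector_derivative[OF L
          smooth_on_interval_derivative(2)[OF conjunct1[OF pieces[OF st]] \<open>s < t\<close> x]], of "- L A"]
    unfolding \<phi>_def by simp
  have "(\<forall>x\<in>{c..d}. \<psi> x = \<psi> c) \<and> strict_mono_on {c..d} \<phi>"
    using T(1-4)
  proof (rule partition_induct)
    fix s t assume st: "s \<in> T" "t \<in> T" "s < t" "{s<..<t} \<inter> T = {}"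
    note D = smooth_on_interval_derivative[OF conjunct1[OF pieces[OF st]] \<open>s < t\<close>]
    have "(\<psi> has_vector_derivative 0) (at x within {s..t})" if x: "x \<in> {s..t}" for x
    proof -
      have "(\<psi> has_vector_derivative (?D s t x - L (?D s t x) *\<^sub>R w)) (at x within {s..t})"
        unfolding \<psi>_def
        by (rule has_vector_derivative_diff[OF D(2)[OF x]
              bounded_linear.has_vector_derivative[OF bounded_linear_scaleR_left \<phi>D[OF st x]]])
      then show ?thesis using dir[OF st x] by simp
    qed
    then obtain k where "\<And>x. x \<in> {s..t} \<Longrightarrow> \<psi> x = k"
      using has_vector_derivative_zero_constant[of "{s..t}" \<psi>] by (metis convex_closed_interval)
    then have "\<forall>x\<in>{s..t}. \<psi> x = \<psi> s" using \<open>s < t\<close> by simp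
    moreover have "\<phi> x < \<phi> y" if xy: "x \<in> {s..t}" "y \<in> {s..t}" "x < y" for x y
    \<comment> \<open>At interior points the one-sided derivative is two-sided; continuity takes
      care of the ends.\<close>
    proof (rule DERIV_pos_imp_increasing_open[OF \<open>x < y\<close>])
      fix z assume "x < z" "z < y"
      then have z: "z \<in> {s..t}" "z \<in> interior {s..t}" using xy by auto
      then show "\<exists>y. (\<phi> has_real_derivative y) (at z) \<and> 0 < y"
        using \<phi>D[OF st z(1)] conjunct1[OF dir[OF st z(1)]] at_within_interior[OF z(2)]
        by (metis has_real_derivative_iff_has_vector_derivative)
    next
      have "continuous_on {s..t} \<phi>"
        using \<phi>D[OF st] by (meson continuous_on_eq_continuous_within has_vector_derivative_continuous)
      then show "continuous_on {x..y} \<phi>"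
        by (rule continuous_on_subset) (use xy in auto)
    qed
    ultimately show "(\<forall>x\<in>{s..t}. \<psi> x = \<psi> s) \<and> strict_mono_on {s..t} \<phi>"
      by (blast intro: strict_mono_onI)
  next
    fix s m t :: real
    assume sm: "s < m" "m < t"
      and 1: "(\<forall>x\<in>{s..m}. \<psi> x = \<psi> s) \<and> strict_mono_on {s..m} \<phi>"
      and 2: "(\<forall>x\<in>{m..t}. \<psi> x = \<psi> m) \<and> strict_mono_on {m..t} \<phi>"
    have "\<psi> x = \<psi> s" if "x \<in> {s..t}" for x
    proof (cases "x \<le> m")
      case True
      then show ?thesis using 1 that by (meson atLeastAtMost_iff)
    next
      case False
      then have "x \<in> {m..t}" "m \<in> {s..m}" using sm that by auto
      then have "\<psi> x = \<psi> m" "\<psi> m = \<psi> s" using 1 2 by blast+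
      then show ?thesis by (rule trans)
    qed
    moreover have "\<phi> x < \<phi> y" if xy: "x \<in> {s..t}" "y \<in> {s..t}" "x < y" for x y
    proof -
      have m1: "\<phi> x < \<phi> y" if "s \<le> x" "x < y" "y \<le> m" for x y
        using strict_mono_onD[OF conjunct2[OF 1], of x y] that by simp
      have m2: "\<phi> x < \<phi> y" if "m \<le> x" "x < y" "y \<le> t" for x y
        using strict_mono_onD[OF conjunct2[OF 2], of x y] that by simp
      consider "y \<le> m" | "m \<le> x" | "x < m" "m < y" by linarith
      then show ?thesis
        using m1[of x y] m2[of x y] m1[of x m] m2[of m y] xy by cases auto
    qed
    ultimately show "(\<forall>x\<in>{s..t}. \<psi> x = \<psi> s) \<and> strict_mono_on {s..t} \<phi>"
      by (blast intro: strict_mono_onI)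
  qed
  then have const: "\<And>x. x \<in> {c..d} \<Longrightarrow> \<psi> x = \<psi> c" and mono: "strict_mono_on {c..d} \<phi>"
    by blast+
  have \<phi>c: "\<phi> c = 0" by (simp add: \<phi>_def ends)
  have \<eta>\<phi>: "\<eta> x = A + \<phi> x *\<^sub>R w" if "x \<in> {c..d}" for x
    using const[OF that] by (simp add: \<psi>_def \<phi>c ends algebra_simps)
  have "w = \<phi> d *\<^sub>R w" using \<eta>\<phi>[of d] T(4) by (simp add: ends w_def algebra_simps)
  then have \<phi>d: "\<phi> d = 1" using w by (metis scaleR_cancel_right scaleR_one)
  have "smooth_on {s..t} \<phi> \<and> (\<forall>x\<in>{s..t}. vector_derivative \<phi> (at x within {s..t}) \<noteq> 0)"
    if st: "s \<in> T" "t \<in> T" "s < t" "{s<..<t} \<inter> T = {}" for s t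
  proof
    show "smooth_on {s..t} \<phi>"
      using pieces[OF st] Ck_on_bounded_linear[OF \<open>s < t\<close> L] unfolding smooth_on_def \<phi>_def by blast
    show "\<forall>x\<in>{s..t}. vector_derivative \<phi> (at x within {s..t}) \<noteq> 0"
    proof
      fix x assume x: "x \<in> {s..t}"
      have "vector_derivative \<phi> (at x within {s..t}) = L (?D s t x)"
        using vector_derivative_within_cbox[of s t x \<phi>] \<phi>D[OF st x] x \<open>s < t\<close> by simp
      then show "vector_derivative \<phi> (at x within {s..t}) \<noteq> 0"
        using conjunct1[OF dir[OF st x]] by linarith
    qed
  qed
  moreover have "continuous_on {c..d} \<phi>"
    unfolding \<phi>_def by (intro continuous_intros bounded_linear.continuous_on[OF L cont])
  \<comment> \<open>The break points of the given curve also serve for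
    \<open>\<phi>\<close>.\<close>
  ultimately have "regular_curve_from_to 0 1 c d \<phi>"
    unfolding regular_curve_from_to_def regular_curve_def
    using T \<phi>c \<phi>d by (intro conjI exI[of _ T] ballI impI; (elim conjE)?; simp)
  moreover have "\<eta> t = linepath A B (\<phi> t)" if "t \<in> {c..d}" for t
    using \<eta>\<phi>[OF that] by (simp add: linepath_def w_def algebra_simps)
  ultimately show ?thesis
    unfolding reparametrization_of_def using mono by blast
qed

section \<open>Straight and broken lines as competing curves\<close>

lemma vector_derivative_line_within:
  assumes "s < t" "x \<in> {s..t}" "\<And>x. x \<in> {s..t} \<Longrightarrow> \<gamma> x = p + x *\<^sub>R v"
  shows "vector_derivative \<gamma> (at x within {s..t}) = v"
proof -
  have "((\<lambda>x. p + x *\<^sub>R v) has_vector_derivative v) (at x within {s..t})"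
    by (auto intro!: derivative_eq_intros)
  then have "(\<gamma> has_vector_derivative v) (at x within {s..t})"
    using assms by (intro has_vector_derivative_transform[of x "{s..t}" \<gamma>]) auto
  then show ?thesis
    using vector_derivative_within_cbox[of s t x \<gamma> v] assms by simp
qed

lemma line_piece:
  assumes "s < t" "\<And>x. x \<in> {s..t} \<Longrightarrow> \<gamma> x = p + x *\<^sub>R v" "v \<noteq> 0"
  shows "smooth_on {s..t} \<gamma> \<and> (\<forall>x\<in>{s..t}. vector_derivative \<gamma> (at x within {s..t}) \<noteq> 0)"
  using smooth_on_line[OF assms(1), of p v] vector_derivative_line_within[OF assms(1) _ assms(2)]
    Ck_on_cong[of "{s..t}" \<gamma> "\<lambda>x. p + x *\<^sub>R v"] assms
  unfolding smooth_on_def by simp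

lemma regular_curve_linepath:
  assumes "A \<noteq> B"
  shows "regular_curve_from_to A B 0 1 (linepath A B)"
proof -
  have "smooth_on {0..1} (linepath A B) \<and>
      (\<forall>x\<in>{0..1}. vector_derivative (linepath A B) (at x within {0..1}) \<noteq> 0)"
    using assms by (intro line_piece[of _ _ _ A "B - A"]) (auto simp: linepath_def algebra_simps)
  then show ?thesis
    unfolding regular_curve_from_to_def regular_curve_def
    by (auto simp: linepath_0' linepath_1' intro!: exI[of _ "{0, 1}"])
qed

lemma travel_time_linepath: "travel_time N 0 1 (linepath A B) = N (B - A)"
  by (simp add: travel_time_def)

text \<open>The corner \<open>p\<close> sits at parameter 0, where the factor \<open>x\<close> makes
  both branches agree; the velocities on the two sides are exactly the two legs.\<close>

definition broken_line :: "'a::real_vector \<Rightarrow> 'a \<Rightarrow> 'a \<Rightarrow> real \<Rightarrow> 'a" where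
  "broken_line A p B x = p + x *\<^sub>R (if x \<le> 0 then p - A else B - p)"

lemma broken_line_left: "x \<in> {-1..0} \<Longrightarrow> broken_line A p B x = p + x *\<^sub>R (p - A)"
  by (simp add: broken_line_def)

lemma broken_line_right: "x \<in> {0..1} \<Longrightarrow> broken_line A p B x = p + x *\<^sub>R (B - p)"
  by (cases "x = 0") (auto simp: broken_line_def)

lemma regular_curve_broken_line:
  assumes "p \<noteq> A" "p \<noteq> B"
  shows "regular_curve_from_to A B (-1) 1 (broken_line A p B)"
proof -
  let ?\<gamma> = "broken_line A p B"
  have 1: "smooth_on {-1..0} ?\<gamma> \<and> (\<forall>x\<in>{-1..0}. vector_derivative ?\<gamma> (at x within {-1..0}) \<noteq> 0)"
    using assms broken_line_left by (intro line_piece[of _ _ _ p "p - A"]) auto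
  have 2: "smooth_on {0..1} ?\<gamma> \<and> (\<forall>x\<in>{0..1}. vector_derivative ?\<gamma> (at x within {0..1}) \<noteq> 0)"
    using assms broken_line_right by (intro line_piece[of _ _ _ p "B - p"]) auto
  have "smooth_on {s..t} ?\<gamma> \<and> (\<forall>x\<in>{s..t}. vector_derivative ?\<gamma> (at x within {s..t}) \<noteq> 0)"
    if st: "s \<in> {-1, 0, 1::real}" "t \<in> {-1, 0, 1}" "s < t" "{s<..<t} \<inter> {-1, 0, 1} = {}" for s t
  proof -
    have "s = -1 \<and> t = 0 \<or> s = 0 \<and> t = 1" using st by auto
    then show ?thesis using 1 2 by blast
  qed
  moreover have "continuous_on {-1..0} ?\<gamma>" "continuous_on {0..1} ?\<gamma>"
    using 1 2 unfolding smooth_on_def by (metis Ck_on.simps(1))+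
  then have "continuous_on ({-1..0} \<union> {0..1}) ?\<gamma>"
    by (rule continuous_on_closed_Un[rotated 2]) auto
  then have "continuous_on {-1..1} ?\<gamma>"
    by (rule continuous_on_subset) auto
  moreover have "?\<gamma> (-1) = A" "?\<gamma> 1 = B" by (simp_all add: broken_line_def)
  ultimately show ?thesis
    unfolding regular_curve_from_to_def regular_curve_def
    by (intro conjI exI[of _ "{-1, 0, 1}"]) auto
qed

lemma travel_time_broken_line:
  "travel_time N (-1) 1 (broken_line A p B) = N (p - A) + N (B - p)"
proof -
  let ?\<gamma> = "broken_line A p B"
  have D1: "vector_derivative ?\<gamma> (at x) = p - A" if "x \<in> {-1<..<0}" for x
    using vector_derivative_line_within[of "-1" 0 x ?\<gamma> p "p - A", OF _ _ broken_line_left] that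
      at_within_interior[of x "{-1..0}"] by simp
  have D2: "vector_derivative ?\<gamma> (at x) = B - p" if "x \<in> {0<..<1}" for x
    using vector_derivative_line_within[of 0 1 x ?\<gamma> p "B - p", OF _ _ broken_line_right] that
      at_within_interior[of x "{0..1}"] by simp
  have "((\<lambda>x. N (vector_derivative ?\<gamma> (at x))) has_integral N (p - A)) {-1..0}"
    by (rule has_integral_spike_finite[of "{-1, 0}" _ _ "\<lambda>x. N (p - A)"]) (use D1 has_integral_const_real[of "N (p - A)" "-1" 0] in auto)
  moreover have "((\<lambda>x. N (vector_derivative ?\<gamma> (at x))) has_integral N (B - p)) {0..1}"
    by (rule has_integral_spike_finite[of "{0, 1}" _ _ "\<lambda>x. N (B - p)"]) (use D2 has_integral_const_real[of "N (B - p)" 0 1] in auto)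
  ultimately have "((\<lambda>x. N (vector_derivative ?\<gamma> (at x))) has_integral (N (p - A) + N (B - p))) {-1..1}"
    using has_integral_combine[of "-1" 0 1] by fastforce
  then show ?thesis unfolding travel_time_def by (rule integral_unique)
qed

text \<open>The corner is the value at parameter 0, and \<open>\<phi>\<close> sends 0 into the unit
  interval, so the corner lies on the straight path.\<close>

lemma broken_line_reparametrization:
  assumes "reparametrization_of (-1) 1 (broken_line A p B) 0 1 (linepath A B)"
  shows "p \<in> closed_segment A B"
proof -
  obtain \<phi> where \<phi>: "regular_curve_from_to 0 1 (-1) 1 \<phi>" "strict_mono_on {-1..1} \<phi>"
      "\<forall>t\<in>{-1..1}. broken_line A p B t = linepath A B (\<phi> t)"
    using assms unfolding reparametrization_of_def by blast
  have "\<phi> (-1) < \<phi> 0" "\<phi> 0 < \<phi> 1"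
    using strict_mono_onD[OF \<phi>(2)] by simp_all
  then have "\<phi> 0 \<in> {0..1}" using \<phi>(1) by (simp add: regular_curve_from_to_def)
  moreover have "p = linepath A B (\<phi> 0)"
    using \<phi>(3)[rule_format, of 0] by (simp add: broken_line_def)
  ultimately show ?thesis by (metis image_eqI linepath_image_01)
qed

section \<open>Optimality of the whole segment against strict minimality\<close>

theorem corollary5p7:
  fixes F\<alpha> F\<beta> :: "real ^ 'n \<Rightarrow> real" and A B :: "real ^ 'n"
  assumes "CARD('n) \<ge> 2"
    and "minkowski_norm F\<alpha>" and "minkowski_norm F\<beta>"
    and "A \<noteq> B"
    and "multi_convex {F\<alpha>, F\<beta>} (outer_indicatrix F\<alpha> F\<beta>)"
  shows "((\<exists>!p. optimal_tack_point F\<alpha> F\<beta> A B p) \<or>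
          {p. optimal_tack_point F\<alpha> F\<beta> A B p} = closed_segment A B) \<and>
         ({p. optimal_tack_point F\<alpha> F\<beta> A B p} = closed_segment A B \<longleftrightarrow>
            strictly_time_minimizing (outer_norm F\<alpha> F\<beta>) A B 0 1 (linepath A B) \<and>
            F\<alpha> (B - A) = F\<beta> (B - A))"
proof -
  note F = assms(2) and G = assms(3) and AB = assms(4)
  let ?opt = "optimal_tack_point F\<alpha> F\<beta> A B" and ?T = "tack_time F\<alpha> F\<beta> A B"
  let ?N = "outer_norm F\<alpha> F\<beta>"
  have N: "continuous_on UNIV ?N"
    unfolding outer_norm_def
    by (intro continuous_intros minkowski_norm_continuous[OF F] minkowski_norm_continuous[OF G])
  have TAB: "?T A = F\<beta> (B - A)" "?T B = F\<alpha> (B - A)"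
    by (simp_all add: tack_time_def minkowski_norm_zero[OF F] minkowski_norm_zero[OF G])
  have forward: "strictly_time_minimizing ?N A B 0 1 (linepath A B) \<and> F\<alpha> (B - A) = F\<beta> (B - A)"
    if seg: "{p. ?opt p} = closed_segment A B"
  proof
    have "?opt A" "?opt B" using seg by auto
    then have "?T A = ?T B" unfolding optimal_tack_point_def by (meson order_antisym)
    then show eq: "F\<alpha> (B - A) = F\<beta> (B - A)" by (simp add: TAB)
    obtain l where l: "bounded_linear l" "l (B - A) = F\<alpha> (B - A)" "\<And>v. l v \<le> ?N v"
      "\<And>v. l v = ?N v \<Longrightarrow> \<exists>t\<ge>0. v = t *\<^sub>R (B - A)"
      using tack_segment_calibration[OF F G AB seg] by blast
    have time: "travel_time ?N 0 1 (linepath A B) = l (B - A)"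
      using eq l(2) by (simp add: travel_time_linepath outer_norm_def)
    \<comment> \<open>The calibration bounds every competitor from below, and equality would make it
      a reparametrization.\<close>
    show "strictly_time_minimizing ?N A B 0 1 (linepath A B)"
      unfolding strictly_time_minimizing_def time
      using regular_curve_linepath[OF AB] calibration_bound[OF _ N l(1,3)]
        calibration_eq_reparametrization[OF _ N AB l(1,3,4)]
      by (metis order_le_less)
  qed
  have backward: "{p. ?opt p} = closed_segment A B"
    if min: "strictly_time_minimizing ?N A B 0 1 (linepath A B)" and eq: "F\<alpha> (B - A) = F\<beta> (B - A)"
  proof -
    have on: "?T p = F\<alpha> (B - A)" if p: "p \<in> closed_segment A B" for p
    proof -
      obtain s where s: "0 \<le> s" "s \<le> 1" "p = A + s *\<^sub>R (B - A)"
        using p unfolding in_closed_segment_iff by blast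
      show ?thesis
        unfolding s(3) tack_time_on_segment[OF F G s(1,2)] eq by (simp add: algebra_simps)
    qed
    have off: "F\<alpha> (B - A) < ?T p" if p: "p \<notin> closed_segment A B" for p
    proof -
      have "p \<noteq> A" "p \<noteq> B" using p by auto
      then have "regular_curve_from_to A B (-1) 1 (broken_line A p B)"
        by (rule regular_curve_broken_line)
      moreover have "\<not> reparametrization_of (-1) 1 (broken_line A p B) 0 1 (linepath A B)"
        using broken_line_reparametrization p by blast
      ultimately have "travel_time ?N 0 1 (linepath A B) < travel_time ?N (-1) 1 (broken_line A p B)"
        using min unfolding strictly_time_minimizing_def by simp
      \<comment> \<open>\<open>outer_norm\<close> is at most the first norm on the first leg and at
        most the second norm on the second leg.\<close>
      also have "\<dots> \<le> ?T p"
        unfolding travel_time_broken_line by (simp add: tack_time_def outer_norm_def add_mono)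
      finally show ?thesis using eq by (simp add: travel_time_linepath outer_norm_def)
    qed
    have ge: "F\<alpha> (B - A) \<le> ?T q" for q
      using on[of q] off[of q] by fastforce
    show ?thesis
    proof (intro set_eqI iffI)
      fix p assume "p \<in> {p. ?opt p}"
      then have "?T p \<le> F\<alpha> (B - A)" unfolding optimal_tack_point_def by (metis TAB(2) mem_Collect_eq)
      then show "p \<in> closed_segment A B" using off[of p] by fastforce
    next
      fix p assume "p \<in> closed_segment A B"
      then show "p \<in> {p. ?opt p}" using on ge by (simp add: optimal_tack_point_def)
    qed
  qed
  show ?thesis
    using optimal_tack_points_dichotomy[OF F G AB] forward backward by blast
qed

end
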